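(* Let $G$, $H$ be totally disconnected locally compact groups and $\phi:G\to G$, $\psi:H\to H$ topological automorphisms. Then $s(\phi\times\psi)=s(\phi)\cdot s(\psi)$, where $\phi\times\psi:G\times H\to G\times H$ is the product automorphism.
   Context: A topological automorphism is a group automorphism that is also a homeomorphism. For a totally disconnected locally compact group $G$, $\mathcal B(G)$ denotes the family of all compact open subgroups of $G$. For a topological automorphism $\phi$ of $G$ and $U\in\mathcal B(G)$ put $s(\phi,U)=[\phi(U):U\cap\phi(U)]$ (a finite index); the scale of $\phi$ is $s(\phi)=\min\{s(\phi,U):U\in\mathcal B(G)\}$. *)

theory Defs
  imports "HOL-Algebra.Coset" "HOL-Analysis.Abstract_Topological_Spaces"
begin

definition totally_disconnected_space :: "'a topology \<Rightarrow> bool" where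
  "totally_disconnected_space X \<longleftrightarrow> (\<forall>S. connectedin X S \<longrightarrow> (\<exists>a. S \<subseteq> {a}))"

locale topological_group = group G for G (structure) and T :: "'a topology" +
  assumes topspace_eq_carrier: "topspace T = carrier G"
    and continuous_map_mult: "continuous_map (prod_topology T T) T (\<lambda>(x, y). x \<otimes> y)"
    and continuous_map_m_inv: "continuous_map T T (\<lambda>x. inv x)"

text \<open>The Hausdorff property is not assumed separately: a totally disconnected space is
  T1, and a T1 topological group is Hausdorff.\<close>

locale tdlc_group = topological_group +
  assumes totally_disconnected: "totally_disconnected_space T"
    and locally_compact: "locally_compact_space T"

definition topological_automorphism ::
    "('a, 'm) monoid_scheme \<Rightarrow> 'a topology \<Rightarrow> ('a \<Rightarrow> 'a) \<Rightarrow> bool" where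
  "topological_automorphism G T \<phi> \<longleftrightarrow> \<phi> \<in> iso G G \<and> homeomorphic_map T T \<phi>"

definition compact_open_subgroups ::
    "('a, 'm) monoid_scheme \<Rightarrow> 'a topology \<Rightarrow> 'a set set" where
  "compact_open_subgroups G T = {U. subgroup U G \<and> compactin T U \<and> openin T U}"

text \<open>The index \<open>[K : L]\<close> of subgroups \<open>L \<subseteq> K\<close> of \<open>G\<close>. It is \<open>0\<close> by the convention on
  \<^const>\<open>card\<close> if there are infinitely many cosets; below, \<open>K\<close> is compact and \<open>L\<close> is open, so that
  this does not happen.\<close>

definition subgroup_index :: "('a, 'm) monoid_scheme \<Rightarrow> 'a set \<Rightarrow> 'a set \<Rightarrow> nat" where
  "subgroup_index G K L = card (rcosets\<^bsub>G\<lparr>carrier := K\<rparr>\<^esub> L)"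

definition scale_at :: "('a, 'm) monoid_scheme \<Rightarrow> ('a \<Rightarrow> 'a) \<Rightarrow> 'a set \<Rightarrow> nat" where
  "scale_at G \<phi> U = subgroup_index G (\<phi> ` U) (U \<inter> \<phi> ` U)"

text \<open>\<^const>\<open>Least\<close> rather than \<^const>\<open>Min\<close>, which is meaningful for finite sets only. By van
  Dantzig's theorem a totally disconnected locally compact group has a compact open subgroup, so
  the minimum is attained.\<close>

definition automorphism_scale :: "('a, 'm) monoid_scheme \<Rightarrow> 'a topology \<Rightarrow> ('a \<Rightarrow> 'a) \<Rightarrow> nat" where
  "automorphism_scale G T \<phi> = (LEAST n. \<exists>U \<in> compact_open_subgroups G T. n = scale_at G \<phi> U)"

end

theory Submission
  imports Defs
begin

text \<open>Write \<open>\<Phi>\<close> for \<open>\<phi> \<times> \<psi>\<close>. The inequality \<open>s(\<Phi>) \<le> s(\<phi>) s(\<psi>)\<close> comes from the product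
  \<open>U \<times> V\<close> of minimizing subgroups, since indices multiply over products
  (\<open>subgroup_index_Times\<close>).

  For the converse inequality it suffices to bound the scale at an arbitrary compact open subgroup
  \<open>W\<close> of \<open>G \<times> H\<close>, which need not be a product. It is an extension of its projection
  \<open>V = snd(W)\<close> by its fibre \<open>U = {g. (g, 1) \<in> W}\<close>, and both of these are again compact open. The
  fibre of \<open>\<Phi>(W)\<close> is \<open>\<phi>(U)\<close> and the fibre of \<open>W \<inter> \<Phi>(W)\<close> is \<open>U \<inter> \<phi>(U)\<close>; the projection of
  \<open>\<Phi>(W)\<close> is \<open>\<psi>(V)\<close>, while that of \<open>W \<inter> \<Phi>(W)\<close> is only contained in \<open>V \<inter> \<psi>(V)\<close>. As the index
  of a subgroup is the product of the indices of fibre and projection, this gives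
  \<open>[\<Phi>(W) : W \<inter> \<Phi>(W)] \<ge> [\<phi>(U) : U \<inter> \<phi>(U)] [\<psi>(V) : V \<inter> \<psi>(V)] \<ge> s(\<phi>) s(\<psi>)\<close>, the
  containment costing only an inequality in the right direction (\<open>subgroup_index_DirProd_ge\<close>,
  \<open>scale_at_DirProd_ge\<close>).

  Two topological facts support this. The minima are taken over nonempty families by van Dantzig's
  theorem (\<open>van_Dantzig\<close>), which rests on the coincidence of components and quasi-components at
  compact components of a locally compact Hausdorff space. And the indices are finite by
  compactness (\<open>finite_rcosets_compact_open\<close>), so that the value \<open>0\<close> that stands for an infinite
  index cannot spoil the lower bound.\<close>

section \<open>Topological groups\<close>

context topological_group
begin

lemma continuous_map_mult_left:
  assumes "a \<in> carrier G"
  shows "continuous_map T T (\<lambda>x. a \<otimes> x)"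
proof -
  have "continuous_map T (prod_topology T T) (\<lambda>x. (a, x))"
    using assms by (simp add: continuous_map_pairedI topspace_eq_carrier)
  from continuous_map_compose[OF this continuous_map_mult] show ?thesis
    by (simp add: o_def)
qed

lemma continuous_map_mult_right:
  assumes "a \<in> carrier G"
  shows "continuous_map T T (\<lambda>x. x \<otimes> a)"
proof -
  have "continuous_map T (prod_topology T T) (\<lambda>x. (x, a))"
    using assms by (simp add: continuous_map_pairedI topspace_eq_carrier)
  from continuous_map_compose[OF this continuous_map_mult] show ?thesis
    by (simp add: o_def)
qed

lemma openin_translate_left:
  assumes "openin T V" "g \<in> carrier G"
  shows "openin T {x \<in> carrier G. inv g \<otimes> x \<in> V}"
  using openin_continuous_map_preimage[OF continuous_map_mult_left assms(1), of "inv g"] assms(2)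
  by (simp add: topspace_eq_carrier)

lemma openin_r_coset:
  assumes "openin T L" "a \<in> carrier G"
  shows "openin T (L #> a)"
proof -
  have L: "L \<subseteq> carrier G"
    using openin_subset[OF assms(1)] by (simp add: topspace_eq_carrier)
  have "{x \<in> topspace T. x \<otimes> inv a \<in> L} = L #> a"
  proof (intro equalityI subsetI)
    fix x assume "x \<in> {x \<in> topspace T. x \<otimes> inv a \<in> L}"
    moreover from this have "x = (x \<otimes> inv a) \<otimes> a"
      using assms(2) by (simp add: topspace_eq_carrier m_assoc)
    ultimately show "x \<in> L #> a"
      unfolding r_coset_def by blast
  next
    fix x assume "x \<in> L #> a"
    then obtain l where "l \<in> L" "x = l \<otimes> a"
      unfolding r_coset_def by blast
    then show "x \<in> {x \<in> topspace T. x \<otimes> inv a \<in> L}"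
      using assms(2) L by (auto simp: topspace_eq_carrier m_assoc)
  qed
  then show ?thesis
    using openin_continuous_map_preimage[OF continuous_map_mult_right assms(1), of "inv a"] assms(2)
    by simp
qed

lemma subgroup_openI:
  assumes U: "subgroup U G" and V: "openin T V" "\<one> \<in> V" "V \<subseteq> U"
  shows "openin T U"
proof (subst openin_subopen, intro ballI exI conjI)
  fix g assume g: "g \<in> U"
  interpret U: subgroup U G by fact
  show "openin T {x \<in> carrier G. inv g \<otimes> x \<in> V}"
    using openin_translate_left V g by simp
  show "g \<in> {x \<in> carrier G. inv g \<otimes> x \<in> V}"
    using g V by simp
  show "{x \<in> carrier G. inv g \<otimes> x \<in> V} \<subseteq> U"
  proof clarify
    fix x assume x: "x \<in> carrier G" "inv g \<otimes> x \<in> V"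
    then have "g \<otimes> (inv g \<otimes> x) \<in> U"
      using g V by blast
    then show "x \<in> U"
      using x(1) g by (simp add: m_assoc[symmetric])
  qed
qed

text \<open>The complement of an open subgroup is a union of cosets, which are open.\<close>

lemma open_subgroup_closed:
  assumes U: "subgroup U G" and "openin T U"
  shows "closedin T U"
  unfolding closedin_def
proof
  interpret U: subgroup U G by fact
  show "U \<subseteq> topspace T"
    using U.subset by (simp add: topspace_eq_carrier)
  show "openin T (topspace T - U)"
  proof (subst openin_subopen, intro ballI exI conjI)
    fix g assume g: "g \<in> topspace T - U"
    show "openin T {x \<in> carrier G. inv g \<otimes> x \<in> U}"
      using openin_translate_left assms(2) g by (simp add: topspace_eq_carrier)
    show "g \<in> {x \<in> carrier G. inv g \<otimes> x \<in> U}"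
      using g by (simp add: topspace_eq_carrier)
    have "g \<in> U" if "x \<in> U" "inv g \<otimes> x \<in> U" for x
    proof -
      have "x \<otimes> inv (inv g \<otimes> x) \<in> U"
        using that by simp
      then show ?thesis
        using that(1) g by (simp add: topspace_eq_carrier inv_mult_group m_assoc[symmetric])
    qed
    then show "{x \<in> carrier G. inv g \<otimes> x \<in> U} \<subseteq> topspace T - U"
      using g by (auto simp: topspace_eq_carrier)
  qed
qed

text \<open>The cosets that meet \<open>K\<close> form an open cover of \<open>K\<close>, and as distinct cosets are disjoint,
  no proper subfamily covers \<open>K\<close>.\<close>

lemma finite_rcosets_compact_open:
  assumes K: "compactin T K" and L: "subgroup L G" "openin T L"
  shows "finite ((\<lambda>k. L #> k) ` K)"
proof -
  have KG: "K \<subseteq> carrier G"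
    using compactin_subset_topspace[OF K] by (simp add: topspace_eq_carrier)
  have "openin T U" if "U \<in> (\<lambda>k. L #> k) ` K" for U
    using that openin_r_coset L KG by blast
  moreover have "K \<subseteq> \<Union>((\<lambda>k. L #> k) ` K)"
  proof
    fix k assume "k \<in> K"
    then show "k \<in> \<Union>((\<lambda>k. L #> k) ` K)"
      using rcos_self[OF subsetD[OF KG] L(1)] by (intro UnionI[of "L #> k"] imageI) auto
  qed
  ultimately obtain F where F: "finite F" "F \<subseteq> (\<lambda>k. L #> k) ` K" "K \<subseteq> \<Union>F"
    using compactinD[OF K, of "(\<lambda>k. L #> k) ` K"] by auto
  have "(\<lambda>k. L #> k) ` K \<subseteq> F"
  proof clarify
    fix k assume "k \<in> K"
    then have "k \<in> \<Union>F"
      using F(3) by (rule subsetD[rotated])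
    then obtain c where c: "c \<in> F" "k \<in> c" ..
    have "c \<in> (\<lambda>k. L #> k) ` K"
      using F(2) c(1) by (rule subsetD)
    then obtain k' where k': "k' \<in> K" "L #> k' \<in> F" "k \<in> L #> k'"
      using c by auto
    then have "L #> k' = L #> k"
      using KG by (intro repr_independence[OF _ _ L(1)]) auto
    with k'(2) show "L #> k \<in> F"
      by simp
  qed
  then show ?thesis
    using F(1) finite_subset by blast
qed

text \<open>The subgroup is the stabilizer \<open>{g. C g = C}\<close>, which lies in \<open>C\<close> because \<open>\<one> \<in> C\<close>. It is open
  because multiplication maps \<open>C \<times> {\<one>}\<close> into the open set \<open>C\<close>: by compactness of \<open>C\<close>, the tube
  lemma turns this into \<open>C \<times> V\<close> for a neighbourhood \<open>V\<close> of \<open>\<one>\<close>.\<close>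

lemma compact_open_subgroup_within_compact_open:
  assumes C: "compactin T C" "openin T C" "\<one> \<in> C"
  obtains U where "U \<in> compact_open_subgroups G T" "U \<subseteq> C"
proof -
  define U where "U = {g \<in> carrier G. \<forall>c\<in>C. c \<otimes> g \<in> C \<and> c \<otimes> inv g \<in> C}"
  have CG: "C \<subseteq> carrier G"
    using openin_subset[OF C(2)] by (simp add: topspace_eq_carrier)
  have U: "subgroup U G"
  proof (rule subgroup.intro)
    show "U \<subseteq> carrier G" by (auto simp: U_def)
    show "\<one> \<in> U" using CG by (auto simp: U_def)
    show "inv x \<in> U" if "x \<in> U" for x using that by (auto simp: U_def)
    show "x \<otimes> y \<in> U" if "x \<in> U" "y \<in> U" for x y
    proof -
      have "c \<otimes> (x \<otimes> y) = (c \<otimes> x) \<otimes> y" "c \<otimes> inv (x \<otimes> y) = (c \<otimes> inv y) \<otimes> inv x" if "c \<in> C" for c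
      proof -
        have "c \<in> carrier G" "x \<in> carrier G" "y \<in> carrier G"
          using that \<open>x \<in> U\<close> \<open>y \<in> U\<close> CG by (auto simp: U_def)
        then show "c \<otimes> (x \<otimes> y) = (c \<otimes> x) \<otimes> y" "c \<otimes> inv (x \<otimes> y) = (c \<otimes> inv y) \<otimes> inv x"
          by (simp_all add: m_assoc inv_mult_group)
      qed
      moreover have "c \<otimes> x \<otimes> y \<in> C" "c \<otimes> inv y \<otimes> inv x \<in> C" if "c \<in> C" for c
        using that \<open>x \<in> U\<close> \<open>y \<in> U\<close> unfolding U_def by blast+
      ultimately show ?thesis
        using that unfolding U_def by auto
    qed
  qed
  define Q where "Q = {p \<in> topspace (prod_topology T T). (\<lambda>(x, y). x \<otimes> y) p \<in> C}"
  have "openin (prod_topology T T) Q"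
    unfolding Q_def by (rule openin_continuous_map_preimage[OF continuous_map_mult C(2)])
  moreover have "C \<times> {\<one>} \<subseteq> Q"
    using CG by (auto simp: Q_def topspace_eq_carrier)
  moreover have "\<one> \<in> topspace T"
    by (simp add: topspace_eq_carrier)
  ultimately have "\<exists>A V. openin T A \<and> openin T V \<and> C \<subseteq> A \<and> \<one> \<in> V \<and> A \<times> V \<subseteq> Q"
    using tube_lemma_left[OF _ C(1)] by simp
  then obtain A V where AV: "openin T A" "openin T V" "C \<subseteq> A" "\<one> \<in> V" "A \<times> V \<subseteq> Q"
    by (elim exE conjE)
  \<comment> \<open>The stabilizer asks for invariance under \<open>g\<close> and \<open>inv g\<close>, so \<open>V\<close> is made symmetric.\<close>
  define V' where "V' = V \<inter> {x \<in> topspace T. inv x \<in> V}"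
  have "openin T V'"
    unfolding V'_def using AV(2) openin_continuous_map_preimage[OF continuous_map_m_inv] by blast
  moreover have "\<one> \<in> V'"
    using AV(4) by (simp add: V'_def topspace_eq_carrier)
  moreover have "V' \<subseteq> U"
  proof
    fix v assume v: "v \<in> V'"
    have "c \<otimes> v \<in> C \<and> c \<otimes> inv v \<in> C" if "c \<in> C" for c
    proof -
      have "(c, v) \<in> A \<times> V" "(c, inv v) \<in> A \<times> V"
        using that v AV(3) by (auto simp: V'_def)
      from this[THEN subsetD[OF AV(5)]] show ?thesis
        by (simp add: Q_def)
    qed
    then show "v \<in> U"
      using v by (simp add: U_def V'_def topspace_eq_carrier)
  qed
  ultimately have openU: "openin T U"
    using subgroup_openI[OF U] by blast
  have UC: "U \<subseteq> C"
  proof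
    fix g assume "g \<in> U"
    then have "\<one> \<otimes> g \<in> C" "g \<in> carrier G" using C(3) by (auto simp: U_def)
    then show "g \<in> C" by simp
  qed
  have "compactin T U"
    using closed_compactin[OF C(1) UC open_subgroup_closed[OF U openU]] .
  then show thesis
    using that U openU UC by (simp add: compact_open_subgroups_def)
qed

text \<open>The diagonal is the preimage of the closed set \<open>{\<one>}\<close> under \<open>(x, y) \<mapsto> x inv y\<close>.\<close>

lemma Hausdorff_if_t1:
  assumes "t1_space T"
  shows "Hausdorff_space T"
proof -
  have "continuous_map (prod_topology T T) (prod_topology T T) (\<lambda>p. (fst p, inv (snd p)))"
    using continuous_map_compose[OF continuous_map_snd continuous_map_m_inv]
    by (intro continuous_map_pairedI) (auto simp: o_def continuous_map_fst)
  from continuous_map_compose[OF this continuous_map_mult]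
  have "continuous_map (prod_topology T T) T (\<lambda>p. fst p \<otimes> inv (snd p))"
    by (simp add: o_def)
  moreover have "closedin T {\<one>}"
    using assms by (simp add: t1_space_closedin_singleton topspace_eq_carrier)
  ultimately have "closedin (prod_topology T T)
      {p \<in> topspace (prod_topology T T). fst p \<otimes> inv (snd p) \<in> {\<one>}}"
    by (rule closedin_continuous_map_preimage)
  moreover have "{p \<in> topspace (prod_topology T T). fst p \<otimes> inv (snd p) \<in> {\<one>}} =
      (\<lambda>x. (x, x)) ` topspace T"
    using inv_solve_right' by (auto simp: topspace_eq_carrier)
  ultimately show ?thesis
    by (simp add: Hausdorff_space_closedin_diagonal)
qed

end

text \<open>The closure of a point is connected.\<close>

lemma totally_disconnected_imp_t1:
  assumes "totally_disconnected_space X"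
  shows "t1_space X"
  unfolding t1_space_closedin_singleton
proof
  fix x assume x: "x \<in> topspace X"
  then have "connectedin X (X closure_of {x})"
    by (simp add: connectedin_closure_of)
  then obtain a where "X closure_of {x} \<subseteq> {a}"
    using assms unfolding totally_disconnected_space_def by blast
  moreover have "{x} \<subseteq> X closure_of {x}"
    using x by (intro closure_of_subset) simp
  ultimately have "X closure_of {x} = {x}" by blast
  then show "closedin X {x}"
    using closure_of_eq by metis
qed

text \<open>The component of \<open>\<one>\<close> is \<open>{\<one>}\<close>. In a locally compact Hausdorff space a compact component has
  arbitrarily small clopen neighbourhoods, and those inside a compact set are compact; the
  stabilizer of such a neighbourhood is the required subgroup.\<close>

theorem (in tdlc_group) van_Dantzig:
  assumes W: "openin T W" "\<one> \<in> W"
  obtains U where "U \<in> compact_open_subgroups G T" "U \<subseteq> W"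
proof -
  have Haus: "Hausdorff_space T"
    using Hausdorff_if_t1 totally_disconnected_imp_t1 totally_disconnected by blast
  have one: "\<one> \<in> topspace T"
    by (simp add: topspace_eq_carrier)
  obtain N K where NK: "openin T N" "compactin T K" "\<one> \<in> N" "N \<subseteq> K"
    using locally_compact one unfolding locally_compact_space_def by blast
  obtain a where "connected_component_of_set T \<one> \<subseteq> {a}"
    using totally_disconnected connectedin_connected_component_of
    unfolding totally_disconnected_space_def by metis
  moreover have "\<one> \<in> connected_component_of_set T \<one>"
    using one by (simp add: connected_component_of_refl)
  ultimately have "connected_component_of_set T \<one> = {\<one>}" by blast
  then have "{\<one>} \<in> connected_components_of T"
    using one connected_component_in_connected_components_of by metis
  then obtain C D where CD: "openin T C" "openin T D" "disjnt C D" "C \<union> D = topspace T"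
      "{\<one>} \<subseteq> C" "C \<subseteq> N \<inter> W"
    using wilder_locally_compact_component_thm[OF locally_compact Haus, of "{\<one>}" "N \<inter> W"] NK W one
    by (auto simp: openin_Int)
  have "topspace T - D = C"
    using CD by (auto simp: disjnt_iff)
  then have "closedin T C"
    using CD(2) by (metis closedin_diff closedin_topspace)
  then have "compactin T C"
    using closed_compactin[OF NK(2)] CD(6) NK(4) by blast
  then obtain U where "U \<in> compact_open_subgroups G T" "U \<subseteq> C"
    using compact_open_subgroup_within_compact_open[of C] CD by blast
  then show thesis
    using that CD(6) by blast
qed

lemma topological_group_DirProd:
  assumes "topological_group G S" "topological_group H T"
  shows "topological_group (G \<times>\<times> H) (prod_topology S T)"
proof -
  interpret G: topological_group G S by fact
  interpret H: topological_group H T by fact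
  interpret P: group "G \<times>\<times> H" by (rule DirProd_group) unfold_locales
  let ?P = "prod_topology S T"
  have c: "continuous_map (prod_topology ?P ?P) S (\<lambda>p. fst (fst p))"
      "continuous_map (prod_topology ?P ?P) S (\<lambda>p. fst (snd p))"
      "continuous_map (prod_topology ?P ?P) T (\<lambda>p. snd (fst p))"
      "continuous_map (prod_topology ?P ?P) T (\<lambda>p. snd (snd p))"
    by (rule continuous_map_compose[unfolded o_def, OF continuous_map_fst continuous_map_fst]
        continuous_map_compose[unfolded o_def, OF continuous_map_snd continuous_map_fst]
        continuous_map_compose[unfolded o_def, OF continuous_map_fst continuous_map_snd]
        continuous_map_compose[unfolded o_def, OF continuous_map_snd continuous_map_snd])+
  show ?thesis
  proof
    show "topspace ?P = carrier (G \<times>\<times> H)"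
      by (simp add: G.topspace_eq_carrier H.topspace_eq_carrier)
    have "continuous_map (prod_topology ?P ?P) S (\<lambda>p. fst (fst p) \<otimes>\<^bsub>G\<^esub> fst (snd p))"
      using continuous_map_compose[OF continuous_map_pairedI[OF c(1,2)] G.continuous_map_mult]
      by (simp add: o_def)
    moreover have "continuous_map (prod_topology ?P ?P) T (\<lambda>p. snd (fst p) \<otimes>\<^bsub>H\<^esub> snd (snd p))"
      using continuous_map_compose[OF continuous_map_pairedI[OF c(3,4)] H.continuous_map_mult]
      by (simp add: o_def)
    ultimately show "continuous_map (prod_topology ?P ?P) ?P (\<lambda>(x, y). x \<otimes>\<^bsub>G \<times>\<times> H\<^esub> y)"
      by (simp add: continuous_map_pairedI case_prod_unfold mult_DirProd')
    have "continuous_map ?P ?P (\<lambda>p. (inv\<^bsub>G\<^esub> (fst p), inv\<^bsub>H\<^esub> (snd p)))"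
      using continuous_map_compose[OF continuous_map_fst G.continuous_map_m_inv, of T]
        continuous_map_compose[OF continuous_map_snd H.continuous_map_m_inv, of S]
      by (intro continuous_map_pairedI) (simp_all add: o_def)
    then show "continuous_map ?P ?P (\<lambda>p. inv\<^bsub>G \<times>\<times> H\<^esub> p)"
      by (rule continuous_map_eq) (auto simp: G.topspace_eq_carrier H.topspace_eq_carrier
          inv_DirProd[OF G.is_group H.is_group])
  qed
qed

section \<open>Indices of subgroups of a product\<close>

lemma subgroup_index_eq_card_image:
  "subgroup_index G K L = card ((\<lambda>k. L #>\<^bsub>G\<^esub> k) ` K)"
  by (simp add: subgroup_index_def RCOSETS_def r_coset_def UNION_singleton_eq_range)

lemma subgroup_index_Times:
  assumes "L \<noteq> {}" "L' \<noteq> {}"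
  shows "subgroup_index (G \<times>\<times> H) (K \<times> K') (L \<times> L') =
    subgroup_index G K L * subgroup_index H K' L'"
proof -
  let ?A = "(\<lambda>k. L #>\<^bsub>G\<^esub> k) ` K" and ?B = "(\<lambda>k. L' #>\<^bsub>H\<^esub> k) ` K'"
  have "(L \<times> L') #>\<^bsub>G \<times>\<times> H\<^esub> p = (L #>\<^bsub>G\<^esub> fst p) \<times> (L' #>\<^bsub>H\<^esub> snd p)" for p
    by (auto simp: r_coset_def mult_DirProd')
  then have "(\<lambda>k. (L \<times> L') #>\<^bsub>G \<times>\<times> H\<^esub> k) ` (K \<times> K') = (\<lambda>(a, b). a \<times> b) ` (?A \<times> ?B)"
    by (simp add: map_prod_surj_on[OF refl refl, symmetric] image_image case_prod_unfold)
  moreover have "inj_on (\<lambda>(a, b). a \<times> b) (?A \<times> ?B)"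
  proof -
    have "{} \<notin> ?A" "{} \<notin> ?B"
      using assms by (auto simp: r_coset_def)
    then show ?thesis
      by (auto simp: inj_on_def times_eq_iff)
  qed
  ultimately show ?thesis
    by (simp add: subgroup_index_eq_card_image card_image card_cartesian_product)
qed

lemma subgroup_fibre:
  assumes "group G" "group H" "subgroup W (G \<times>\<times> H)"
  shows "subgroup {g. (g, \<one>\<^bsub>H\<^esub>) \<in> W} G"
proof -
  interpret G: group G by fact
  interpret H: group H by fact
  interpret W: subgroup W "G \<times>\<times> H" by fact
  let ?U = "{g. (g, \<one>\<^bsub>H\<^esub>) \<in> W}"
  show ?thesis
  proof (rule subgroup.intro)
    show U: "?U \<subseteq> carrier G" using W.subset by auto
    show "\<one>\<^bsub>G\<^esub> \<in> ?U" using W.one_closed by simp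
    show "x \<otimes>\<^bsub>G\<^esub> y \<in> ?U" if "x \<in> ?U" "y \<in> ?U" for x y
      using W.m_closed[of "(x, \<one>\<^bsub>H\<^esub>)" "(y, \<one>\<^bsub>H\<^esub>)"] that by simp
    show "inv\<^bsub>G\<^esub> x \<in> ?U" if "x \<in> ?U" for x
    proof -
      have "inv\<^bsub>G \<times>\<times> H\<^esub> (x, \<one>\<^bsub>H\<^esub>) = (inv\<^bsub>G\<^esub> x, \<one>\<^bsub>H\<^esub>)"
        using inv_DirProd[OF assms(1,2), of x "\<one>\<^bsub>H\<^esub>"] U that by auto
      moreover have "inv\<^bsub>G \<times>\<times> H\<^esub> (x, \<one>\<^bsub>H\<^esub>) \<in> W"
        using that by (intro subgroup.m_inv_closed[OF assms(3)]) simp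
      ultimately show ?thesis by simp
    qed
  qed
qed

text \<open>If \<open>r\<close> runs through representatives of the cosets of the fibre of \<open>M\<close> in the fibre of \<open>K\<close>, and
  \<open>t\<close> runs through elements of \<open>K\<close> whose projections represent the cosets of \<open>L\<close>, then the elements
  \<open>(r, 1) t\<close> lie in distinct cosets of \<open>M\<close>: the projection of the coset determines \<open>t\<close>, and
  cancelling \<open>t\<close> leaves a coset of the fibre. Finiteness is essential in the conclusion, where an
  infinite index on the right-hand side would be \<open>0\<close>.\<close>

lemma subgroup_index_DirProd_ge:
  assumes "group G" "group H"
    and K: "subgroup K (G \<times>\<times> H)" and M: "subgroup M (G \<times>\<times> H)" and L: "subgroup L H"
    and sub: "snd ` M \<subseteq> L"
    and fin: "finite ((\<lambda>k. M #>\<^bsub>G \<times>\<times> H\<^esub> k) ` K)"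
  shows "subgroup_index G {g. (g, \<one>\<^bsub>H\<^esub>) \<in> K} {g. (g, \<one>\<^bsub>H\<^esub>) \<in> M} * subgroup_index H (snd ` K) L
    \<le> subgroup_index (G \<times>\<times> H) K M"
proof -
  interpret G: group G by fact
  interpret H: group H by fact
  interpret P: group "G \<times>\<times> H" by (rule DirProd_group) fact+
  interpret K: subgroup K "G \<times>\<times> H" by fact
  interpret M: subgroup M "G \<times>\<times> H" by fact
  interpret L: subgroup L H by fact
  define K0 where "K0 = {g. (g, \<one>\<^bsub>H\<^esub>) \<in> K}"
  define M0 where "M0 = {g. (g, \<one>\<^bsub>H\<^esub>) \<in> M}"
  let ?A = "(\<lambda>k. M0 #>\<^bsub>G\<^esub> k) ` K0" and ?B = "(\<lambda>k. L #>\<^bsub>H\<^esub> k) ` (snd ` K)"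
  define r where "r A = (SOME k. k \<in> K0 \<and> A = M0 #>\<^bsub>G\<^esub> k)" for A
  define t where "t B = (SOME k. k \<in> K \<and> B = L #>\<^bsub>H\<^esub> snd k)" for B
  have r: "r A \<in> K0 \<and> A = M0 #>\<^bsub>G\<^esub> r A" if "A \<in> ?A" for A
    unfolding r_def by (rule someI_ex) (use that in blast)
  have t: "t B \<in> K \<and> B = L #>\<^bsub>H\<^esub> snd (t B)" if "B \<in> ?B" for B
    unfolding t_def by (rule someI_ex) (use that in blast)
  have M0: "subgroup M0 G"
    unfolding M0_def by (rule subgroup_fibre) fact+
  define F where "F = (\<lambda>(A, B). M #>\<^bsub>G \<times>\<times> H\<^esub> ((r A, \<one>\<^bsub>H\<^esub>) \<otimes>\<^bsub>G \<times>\<times> H\<^esub> t B))"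
  have "F ` (?A \<times> ?B) \<subseteq> (\<lambda>k. M #>\<^bsub>G \<times>\<times> H\<^esub> k) ` K"
  proof clarify
    fix k h assume "k \<in> K0" "h \<in> K"
    then have "(r (M0 #>\<^bsub>G\<^esub> k), \<one>\<^bsub>H\<^esub>) \<otimes>\<^bsub>G \<times>\<times> H\<^esub> t (L #>\<^bsub>H\<^esub> snd h) \<in> K"
      using r[of "M0 #>\<^bsub>G\<^esub> k"] t[of "L #>\<^bsub>H\<^esub> snd h"] K.m_closed unfolding K0_def by blast
    then show "F (M0 #>\<^bsub>G\<^esub> k, L #>\<^bsub>H\<^esub> snd h) \<in> (\<lambda>k. M #>\<^bsub>G \<times>\<times> H\<^esub> k) ` K"
      by (simp add: F_def)
  qed
  moreover have "inj_on F (?A \<times> ?B)"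
  proof (rule inj_onI)
    fix p q
    assume pq: "p \<in> ?A \<times> ?B" "q \<in> ?A \<times> ?B" "F p = F q"
    obtain A B A' B' where p: "p = (A, B)" and q: "q = (A', B')" by (metis surj_pair)
    have AB: "A \<in> ?A" "B \<in> ?B" "A' \<in> ?A" "B' \<in> ?B" and eq: "F (A, B) = F (A', B')"
      using pq by (simp_all only: p q mem_Times_iff fst_conv snd_conv)
    obtain a b where tB: "t B = (a, b)" by force
    obtain a' b' where tB': "t B' = (a', b')" by force
    have inK: "(r A, \<one>\<^bsub>H\<^esub>) \<in> K" "(r A', \<one>\<^bsub>H\<^esub>) \<in> K" "(a, b) \<in> K" "(a', b') \<in> K"
      using r t AB tB tB' unfolding K0_def by (metis mem_Collect_eq)+
    then have car: "r A \<in> carrier G" "r A' \<in> carrier G" "a \<in> carrier G" "a' \<in> carrier G"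
        "b \<in> carrier H" "b' \<in> carrier H"
      using K.subset by auto
    have "(r A, \<one>\<^bsub>H\<^esub>) \<otimes>\<^bsub>G \<times>\<times> H\<^esub> (a, b) \<in> M #>\<^bsub>G \<times>\<times> H\<^esub> ((r A', \<one>\<^bsub>H\<^esub>) \<otimes>\<^bsub>G \<times>\<times> H\<^esub> (a', b'))"
      using eq P.rcos_self[OF _ M, of "(r A, \<one>\<^bsub>H\<^esub>) \<otimes>\<^bsub>G \<times>\<times> H\<^esub> (a, b)"] car
      by (simp add: F_def tB tB')
    then obtain m n where mn: "(m, n) \<in> M" "r A \<otimes>\<^bsub>G\<^esub> a = m \<otimes>\<^bsub>G\<^esub> (r A' \<otimes>\<^bsub>G\<^esub> a')"
        "b = n \<otimes>\<^bsub>H\<^esub> b'"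
      using car by (auto simp: r_coset_def)
    have mnc: "m \<in> carrier G" "n \<in> carrier H"
      using mn(1) M.subset by auto
    \<comment> \<open>Comparison of the second components gives the same coset of \<open>L\<close>, hence the same lift \<open>t\<close>.\<close>
    have "n \<in> L" using mn(1) sub by force
    then have "b \<in> L #>\<^bsub>H\<^esub> b'"
      using mn(3) by (auto simp: r_coset_def)
    then have "L #>\<^bsub>H\<^esub> b' = L #>\<^bsub>H\<^esub> b"
      using H.repr_independence[OF _ _ L] car by blast
    then have B: "B = B'"
      using t[OF AB(2)] t[OF AB(4)] tB tB' by simp
    then have "a = a'" "b = b'" using tB tB' by auto
    \<comment> \<open>With equal lifts, the element of \<open>M\<close> that relates the two products lies in the fibre.\<close>
    then have "n = \<one>\<^bsub>H\<^esub>"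
      using mn(3) car mnc by (metis H.r_cancel_one')
    moreover have "r A = m \<otimes>\<^bsub>G\<^esub> r A'"
    proof -
      have "r A \<otimes>\<^bsub>G\<^esub> a = (m \<otimes>\<^bsub>G\<^esub> r A') \<otimes>\<^bsub>G\<^esub> a"
        using mn(2) \<open>a = a'\<close> car mnc by (simp add: G.m_assoc)
      then show ?thesis
        using car mnc by simp
    qed
    ultimately have "r A \<in> M0 #>\<^bsub>G\<^esub> r A'"
      using mn(1) by (auto simp: r_coset_def M0_def)
    then have "M0 #>\<^bsub>G\<^esub> r A' = M0 #>\<^bsub>G\<^esub> r A"
      using G.repr_independence[OF _ _ M0] car by blast
    then have "A = A'"
      using r[OF AB(1)] r[OF AB(3)] by simp
    then show "p = q" using B p q by simp
  qed
  ultimately have "card (?A \<times> ?B) \<le> card ((\<lambda>k. M #>\<^bsub>G \<times>\<times> H\<^esub> k) ` K)"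
    using card_inj_on_le fin by blast
  then show ?thesis
    by (simp add: subgroup_index_eq_card_image card_cartesian_product K0_def M0_def)
qed

section \<open>The scale of a product\<close>

lemma scale_at_Times:
  assumes "subgroup U G" "subgroup V H" "\<phi> \<in> hom G G" "\<psi> \<in> hom H H" "group G" "group H"
  shows "scale_at (G \<times>\<times> H) (map_prod \<phi> \<psi>) (U \<times> V) = scale_at G \<phi> U * scale_at H \<psi> V"
proof -
  have "\<one>\<^bsub>G\<^esub> \<in> U \<inter> \<phi> ` U" "\<one>\<^bsub>H\<^esub> \<in> V \<inter> \<psi> ` V"
    using subgroup.one_closed[OF assms(1)] hom_one[OF assms(3,5,5)]
      subgroup.one_closed[OF assms(2)] hom_one[OF assms(4,6,6)]
    by (simp_all add: rev_image_eqI)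
  then have "U \<inter> \<phi> ` U \<noteq> {}" "V \<inter> \<psi> ` V \<noteq> {}"
    by (simp_all only: ex_in_conv[symmetric]) (rule exI, assumption)+
  then show ?thesis
    unfolding scale_at_def map_prod_surj_on[OF refl refl] Times_Int_Times
    by (rule subgroup_index_Times)
qed

lemma compact_open_subgroups_Times:
  assumes "group G" "group H"
    and "U \<in> compact_open_subgroups G S" "V \<in> compact_open_subgroups H T"
  shows "U \<times> V \<in> compact_open_subgroups (G \<times>\<times> H) (prod_topology S T)"
  using assms(3,4) DirProd_subgroups[OF assms(1) _ assms(2)]
  by (simp add: compact_open_subgroups_def compactin_Times openin_prod_Times_iff)

lemma compact_open_subgroups_snd_image:
  assumes "group G" "group H" "W \<in> compact_open_subgroups (G \<times>\<times> H) (prod_topology S T)"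
  shows "snd ` W \<in> compact_open_subgroups H T"
proof -
  have W: "subgroup W (G \<times>\<times> H)" "compactin (prod_topology S T) W" "openin (prod_topology S T) W"
    using assms(3) by (auto simp: compact_open_subgroups_def)
  have "group_hom (G \<times>\<times> H) H snd"
    using assms(1,2) DirProd_group
    by (auto simp: group_hom_def group_hom_axioms_def hom_def)
  then have "subgroup (snd ` W) H"
    using W(1) by (rule group_hom.subgroup_img_is_subgroup)
  moreover have "compactin T (snd ` W)"
    by (rule image_compactin[OF W(2) continuous_map_snd])
  moreover have "openin T (snd ` W)"
    using open_map_snd W(3) unfolding open_map_def by blast
  ultimately show ?thesis
    by (simp add: compact_open_subgroups_def)
qed

text \<open>For compactness, note that the fibre is an open, hence closed, subgroup of \<open>G\<close> that is contained
  in the compact projection \<open>fst ` W\<close>.\<close>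

lemma compact_open_subgroups_fibre:
  assumes "topological_group G S" "topological_group H T"
    and "W \<in> compact_open_subgroups (G \<times>\<times> H) (prod_topology S T)"
  shows "{g. (g, \<one>\<^bsub>H\<^esub>) \<in> W} \<in> compact_open_subgroups G S"
proof -
  interpret G: topological_group G S by fact
  interpret H: topological_group H T by fact
  have W: "subgroup W (G \<times>\<times> H)" "compactin (prod_topology S T) W" "openin (prod_topology S T) W"
    using assms(3) by (auto simp: compact_open_subgroups_def)
  interpret W: subgroup W "G \<times>\<times> H" by fact
  let ?U = "{g. (g, \<one>\<^bsub>H\<^esub>) \<in> W}"
  have U: "subgroup ?U G"
    using subgroup_fibre[OF G.is_group H.is_group W(1)] .
  have "continuous_map S (prod_topology S T) (\<lambda>g. (g, \<one>\<^bsub>H\<^esub>))"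
    by (simp add: continuous_map_pairedI H.topspace_eq_carrier)
  from openin_continuous_map_preimage[OF this W(3)]
  have "openin S {g \<in> topspace S. (g, \<one>\<^bsub>H\<^esub>) \<in> W}" .
  moreover have "{g \<in> topspace S. (g, \<one>\<^bsub>H\<^esub>) \<in> W} = ?U"
    using subgroup.subset[OF U] by (auto simp: G.topspace_eq_carrier)
  ultimately have "openin S ?U" by simp
  moreover have "compactin S ?U"
  proof (rule closed_compactin[OF image_compactin[OF W(2) continuous_map_fst]])
    show "?U \<subseteq> fst ` W" by force
    show "closedin S ?U" using G.open_subgroup_closed[OF U \<open>openin S ?U\<close>] .
  qed
  ultimately show ?thesis
    using U by (simp add: compact_open_subgroups_def)
qed

lemma map_prod_in_hom_DirProd:
  assumes "\<phi> \<in> hom G G'" "\<psi> \<in> hom H H'"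
  shows "map_prod \<phi> \<psi> \<in> hom (G \<times>\<times> H) (G' \<times>\<times> H')"
  using assms by (auto simp: hom_def)

lemma homeomorphic_map_map_prod:
  assumes "homeomorphic_map X X' f" "homeomorphic_map Y Y' g"
  shows "homeomorphic_map (prod_topology X Y) (prod_topology X' Y') (map_prod f g)"
proof -
  obtain f' g' where "homeomorphic_maps X X' f f'" "homeomorphic_maps Y Y' g g'"
    using assms by (auto simp: homeomorphic_map_maps)
  then have "homeomorphic_maps (prod_topology X Y) (prod_topology X' Y')
      (\<lambda>(x, y). (f x, g y)) (\<lambda>(x, y). (f' x, g' y))"
    by (simp add: homeomorphic_maps_prod)
  then show ?thesis
    by (auto simp: homeomorphic_map_maps map_prod_def)
qed

text \<open>The lower bound for indices is applied to \<open>K = \<Phi>(W)\<close>, \<open>M = W \<inter> \<Phi>(W)\<close> and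
  \<open>L = V \<inter> \<psi>(V)\<close> with \<open>V = snd(W)\<close>. Injectivity of \<open>\<psi>\<close> is what makes the fibre of \<open>\<Phi>(W)\<close> over
  the identity equal to the \<open>\<phi>\<close>-image of the fibre of \<open>W\<close>.\<close>

lemma scale_at_DirProd_ge:
  assumes G: "topological_group G S" and H: "topological_group H T"
    and \<phi>: "topological_automorphism G S \<phi>" and \<psi>: "topological_automorphism H T \<psi>"
    and "W \<in> compact_open_subgroups (G \<times>\<times> H) (prod_topology S T)"
  shows "scale_at G \<phi> {g. (g, \<one>\<^bsub>H\<^esub>) \<in> W} * scale_at H \<psi> (snd ` W)
    \<le> scale_at (G \<times>\<times> H) (map_prod \<phi> \<psi>) W"
proof -
  interpret G: topological_group G S by fact
  interpret H: topological_group H T by fact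
  interpret P: topological_group "G \<times>\<times> H" "prod_topology S T"
    using topological_group_DirProd[OF G H] .
  let ?\<Phi> = "map_prod \<phi> \<psi>" and ?P = "prod_topology S T"
  have W: "subgroup W (G \<times>\<times> H)" "compactin ?P W" "openin ?P W"
    using assms(5) by (auto simp: compact_open_subgroups_def)
  interpret W: subgroup W "G \<times>\<times> H" by fact
  have hom: "\<phi> \<in> hom G G" "\<psi> \<in> hom H H" "inj_on \<psi> (carrier H)"
    and homeo: "homeomorphic_map S S \<phi>" "homeomorphic_map T T \<psi>"
    using \<phi> \<psi> by (auto simp: topological_automorphism_def iso_def bij_betw_def)
  have gh: "group_hom (G \<times>\<times> H) (G \<times>\<times> H) ?\<Phi>" "group_hom H H \<psi>"
    using map_prod_in_hom_DirProd[OF hom(1,2)] hom(2)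
    by (simp_all add: group_hom_def group_hom_axioms_def P.is_group H.is_group)
  have homeoP: "homeomorphic_map ?P ?P ?\<Phi>"
    using homeo by (rule homeomorphic_map_map_prod)
  have K: "subgroup (?\<Phi> ` W) (G \<times>\<times> H)"
    using group_hom.subgroup_img_is_subgroup[OF gh(1) W(1)] .
  have M: "subgroup (W \<inter> ?\<Phi> ` W) (G \<times>\<times> H)"
    using P.subgroups_Inter_pair[OF W(1) K] .
  have V: "subgroup (snd ` W) H"
    using compact_open_subgroups_snd_image[OF G.is_group H.is_group assms(5)]
    by (simp add: compact_open_subgroups_def)
  have L: "subgroup (snd ` W \<inter> \<psi> ` snd ` W) H"
    using H.subgroups_Inter_pair[OF V group_hom.subgroup_img_is_subgroup[OF gh(2) V]] .
  have snd: "snd ` ?\<Phi> ` W = \<psi> ` snd ` W"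
    by (simp add: image_image)
  have "compactin ?P (?\<Phi> ` W)" "openin ?P (?\<Phi> ` W)"
    using homeomorphic_map_compactness_eq[OF homeoP, THEN iffD1, OF W(2)]
      homeomorphic_map_openness_eq[OF homeoP, THEN iffD1, OF W(3)]
    by auto
  then have fin: "finite ((\<lambda>k. (W \<inter> ?\<Phi> ` W) #>\<^bsub>G \<times>\<times> H\<^esub> k) ` (?\<Phi> ` W))"
    using W(3) by (intro P.finite_rcosets_compact_open M openin_Int)
  have fibre: "{g. (g, \<one>\<^bsub>H\<^esub>) \<in> ?\<Phi> ` W} = \<phi> ` {g. (g, \<one>\<^bsub>H\<^esub>) \<in> W}"
  proof (intro equalityI subsetI)
    fix g assume "g \<in> {g. (g, \<one>\<^bsub>H\<^esub>) \<in> ?\<Phi> ` W}"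
    then obtain x y where xy: "(x, y) \<in> W" "g = \<phi> x" "\<psi> y = \<one>\<^bsub>H\<^esub>" by auto
    then have "y \<in> carrier H" using W.subset by auto
    then have "y = \<one>\<^bsub>H\<^esub>"
      using inj_onD[OF hom(3), of y "\<one>\<^bsub>H\<^esub>"] xy(3) hom_one[OF hom(2) H.is_group H.is_group]
      by simp
    then show "g \<in> \<phi> ` {g. (g, \<one>\<^bsub>H\<^esub>) \<in> W}" using xy by auto
  next
    fix g assume "g \<in> \<phi> ` {g. (g, \<one>\<^bsub>H\<^esub>) \<in> W}"
    then obtain x where x: "(x, \<one>\<^bsub>H\<^esub>) \<in> W" "g = \<phi> x" by auto
    have "(g, \<one>\<^bsub>H\<^esub>) = ?\<Phi> (x, \<one>\<^bsub>H\<^esub>)"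
      using x(2) hom_one[OF hom(2) H.is_group H.is_group] by simp
    with x(1) show "g \<in> {g. (g, \<one>\<^bsub>H\<^esub>) \<in> ?\<Phi> ` W}"
      by (simp only: mem_Collect_eq image_eqI)
  qed
  have "subgroup_index G {g. (g, \<one>\<^bsub>H\<^esub>) \<in> ?\<Phi> ` W} {g. (g, \<one>\<^bsub>H\<^esub>) \<in> W \<inter> ?\<Phi> ` W} *
      subgroup_index H (snd ` ?\<Phi> ` W) (snd ` W \<inter> \<psi> ` snd ` W)
      \<le> subgroup_index (G \<times>\<times> H) (?\<Phi> ` W) (W \<inter> ?\<Phi> ` W)"
  proof (rule subgroup_index_DirProd_ge[OF G.is_group H.is_group K M L _ fin])
    show "snd ` (W \<inter> ?\<Phi> ` W) \<subseteq> snd ` W \<inter> \<psi> ` snd ` W"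
      unfolding snd[symmetric] by (rule image_Int_subset)
  qed
  moreover have "{g. (g, \<one>\<^bsub>H\<^esub>) \<in> W \<inter> ?\<Phi> ` W} =
      {g. (g, \<one>\<^bsub>H\<^esub>) \<in> W} \<inter> \<phi> ` {g. (g, \<one>\<^bsub>H\<^esub>) \<in> W}"
    unfolding fibre[symmetric] by (simp add: Collect_conj_eq)
  ultimately show ?thesis
    by (simp only: scale_at_def fibre snd)
qed

lemma automorphism_scale_le:
  assumes "U \<in> compact_open_subgroups G T"
  shows "automorphism_scale G T \<phi> \<le> scale_at G \<phi> U"
  unfolding automorphism_scale_def using assms by (intro Least_le) blast

lemma automorphism_scale_attained:
  assumes "compact_open_subgroups G T \<noteq> {}"
  obtains U where "U \<in> compact_open_subgroups G T" "automorphism_scale G T \<phi> = scale_at G \<phi> U"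
proof -
  have "\<exists>n. \<exists>U \<in> compact_open_subgroups G T. n = scale_at G \<phi> U"
    using assms by blast
  from LeastI_ex[OF this] show thesis
    using that unfolding automorphism_scale_def by blast
qed

theorem theorem4p7:
  fixes G :: "('a, 'm) monoid_scheme" and S :: "'a topology" and \<phi> :: "'a \<Rightarrow> 'a"
    and H :: "('b, 'n) monoid_scheme" and T :: "'b topology" and \<psi> :: "'b \<Rightarrow> 'b"
  assumes "tdlc_group G S" and "tdlc_group H T"
    and "topological_automorphism G S \<phi>" and "topological_automorphism H T \<psi>"
  shows "automorphism_scale (G \<times>\<times> H) (prod_topology S T) (map_prod \<phi> \<psi>) =
    automorphism_scale G S \<phi> * automorphism_scale H T \<psi>"
proof (rule antisym)
  interpret G: tdlc_group G S by fact
  interpret H: tdlc_group H T by fact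
  let ?\<Phi> = "map_prod \<phi> \<psi>" and ?P = "prod_topology S T"
  have "compact_open_subgroups G S \<noteq> {}"
    using G.van_Dantzig[of "topspace S"] by (metis G.one_closed G.topspace_eq_carrier empty_iff openin_topspace)
  then obtain U where U: "U \<in> compact_open_subgroups G S" "automorphism_scale G S \<phi> = scale_at G \<phi> U"
    by (rule automorphism_scale_attained)
  have "compact_open_subgroups H T \<noteq> {}"
    using H.van_Dantzig[of "topspace T"] by (metis H.one_closed H.topspace_eq_carrier empty_iff openin_topspace)
  then obtain V where V: "V \<in> compact_open_subgroups H T" "automorphism_scale H T \<psi> = scale_at H \<psi> V"
    by (rule automorphism_scale_attained)
  have UV: "U \<times> V \<in> compact_open_subgroups (G \<times>\<times> H) ?P"
    using compact_open_subgroups_Times[OF G.is_group H.is_group U(1) V(1)] .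
  have "scale_at (G \<times>\<times> H) ?\<Phi> (U \<times> V) = scale_at G \<phi> U * scale_at H \<psi> V"
    using U(1) V(1) assms(3,4)
    by (intro scale_at_Times G.is_group H.is_group)
      (auto simp: compact_open_subgroups_def topological_automorphism_def iso_def)
  then show "automorphism_scale (G \<times>\<times> H) ?P ?\<Phi> \<le> automorphism_scale G S \<phi> * automorphism_scale H T \<psi>"
    using automorphism_scale_le[OF UV] U(2) V(2) by metis
  obtain W where W: "W \<in> compact_open_subgroups (G \<times>\<times> H) ?P"
      "automorphism_scale (G \<times>\<times> H) ?P ?\<Phi> = scale_at (G \<times>\<times> H) ?\<Phi> W"
    using UV automorphism_scale_attained by blast
  have "automorphism_scale G S \<phi> * automorphism_scale H T \<psi> \<le>
      scale_at G \<phi> {g. (g, \<one>\<^bsub>H\<^esub>) \<in> W} * scale_at H \<psi> (snd ` W)"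
    using compact_open_subgroups_fibre[OF G.topological_group_axioms H.topological_group_axioms W(1)]
      compact_open_subgroups_snd_image[OF G.is_group H.is_group W(1)]
    by (intro mult_le_mono automorphism_scale_le)
  also have "\<dots> \<le> scale_at (G \<times>\<times> H) ?\<Phi> W"
    using scale_at_DirProd_ge[OF G.topological_group_axioms H.topological_group_axioms
        assms(3,4) W(1)] .
  finally show "automorphism_scale G S \<phi> * automorphism_scale H T \<psi> \<le>
      automorphism_scale (G \<times>\<times> H) ?P ?\<Phi>"
    using W(2) by simp
qed

end
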